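(* Let $n\ge 2$. There exists a complete non-Kähler, conformally flat Hermitian metric on $\mathbb{C}^n$ whose (Chern) holomorphic sectional curvature is pointwise constant and negative (i.e. $H(X)=c(p)$ for every $p\in\mathbb{C}^n$ and every nonzero $X\in T^{1,0}_p\mathbb{C}^n$, for some function $c<0$) but not globally constant (i.e. $c$ is not a constant function). There also exists a non-Kähler, conformally flat Hermitian metric on $\mathbb{C}^n$ whose (Chern) holomorphic sectional curvature is pointwise constant and positive (the same with $c>0$) but not globally constant.
   Context: For a Hermitian metric $\omega=\sqrt{-1}\,h_{i\bar j}dz^i\wedge d\bar z^j$, the Chern connection has Christoffel symbols $\Gamma_{ij}^k=h^{k\bar l}\partial_i h_{j\bar l}$ and curvature $R_{i\bar jk\bar l}=-h_{p\bar l}\,\partial_{\bar j}\Gamma^p_{ik}$. The holomorphic sectional curvature is $H(X)=R(X,\bar X,X,\bar X)/|X|^4$ for nonzero $X=X^i\frac{\partial}{\partial z^i}\in T^{1,0}_p$, where $R(X,\bar X,X,\bar X)=R_{i\bar jk\bar l}X^i\overline{X^j}X^k\overline{X^l}$ and $|X|^2=h_{i\bar j}X^i\overline{X^j}$. The metric is Kähler if $d\omega=0$, and complete if the underlying Riemannian metric is complete. A Hermitian metric on $\mathbb{C}^n$ is called conformally flat here if it has the form $e^{f}\omega_0$ with $f$ a smooth real function and $\omega_0=\sqrt{-1}\sum_i dz^i\wedge d\bar z^i$ the Euclidean metric. *)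

theory Defs
  imports "HOL-Analysis.Analysis"
begin

primrec C_k :: "nat \<Rightarrow> ('a::euclidean_space \<Rightarrow> 'b::real_normed_vector) \<Rightarrow> bool" where
  "C_k 0 f \<longleftrightarrow> continuous_on UNIV f"
| "C_k (Suc k) f \<longleftrightarrow>
     (\<forall>x. f differentiable (at x)) \<and> (\<forall>v. C_k k (\<lambda>x. frechet_derivative f (at x) v))"

definition smooth :: "('a::euclidean_space \<Rightarrow> 'b::real_normed_vector) \<Rightarrow> bool" where
  "smooth f \<longleftrightarrow> (\<forall>k. C_k k f)"

text \<open>Wirtinger derivatives \<open>\<partial>/\<partial>z\<^sup>i = (\<partial>/\<partial>x\<^sup>i - \<i> \<partial>/\<partial>y\<^sup>i)/2\<close> and
  \<open>\<partial>/\<partial>\<bar>z\<^sup>i = (\<partial>/\<partial>x\<^sup>i + \<i> \<partial>/\<partial>y\<^sup>i)/2\<close>.\<close>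

definition d_z :: "'n \<Rightarrow> (complex^'n \<Rightarrow> complex) \<Rightarrow> complex^'n \<Rightarrow> complex" where
  "d_z i g z = (frechet_derivative g (at z) (axis i 1)
                  - \<i> * frechet_derivative g (at z) (axis i \<i>)) / 2"

definition d_zbar :: "'n \<Rightarrow> (complex^'n \<Rightarrow> complex) \<Rightarrow> complex^'n \<Rightarrow> complex" where
  "d_zbar i g z = (frechet_derivative g (at z) (axis i 1)
                  + \<i> * frechet_derivative g (at z) (axis i \<i>)) / 2"

text \<open>A metric \<open>h\<close> on the whole of complex n-space is given by its coefficient matrix in the
  standard coordinates: \<open>h z $ i $ j\<close> is the coefficient with unbarred index \<open>i\<close> and barred
  index \<open>j\<close>.  A vector \<open>X :: complex^'n\<close> stands for the (1,0)-tangent vector with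
  components \<open>X $ i\<close>.\<close>

definition herm :: "(complex^'n \<Rightarrow> complex^'n^'n) \<Rightarrow> complex^'n \<Rightarrow> complex^'n \<Rightarrow> complex^'n \<Rightarrow> complex" where
  "herm h z X Y = (\<Sum>i\<in>UNIV. \<Sum>j\<in>UNIV. h z $ i $ j * X $ i * cnj (Y $ j))"

definition hermitian_metric :: "(complex^'n \<Rightarrow> complex^'n^'n) \<Rightarrow> bool" where
  "hermitian_metric h \<longleftrightarrow> smooth h
     \<and> (\<forall>z i j. h z $ j $ i = cnj (h z $ i $ j))
     \<and> (\<forall>z X. X \<noteq> 0 \<longrightarrow> Re (herm h z X X) > 0)"

definition conformally_flat :: "(complex^'n \<Rightarrow> complex^'n^'n) \<Rightarrow> bool" where
  "conformally_flat h \<longleftrightarrow>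
     (\<exists>f :: complex^'n \<Rightarrow> real. smooth f \<and> (\<forall>z. h z = mat (complex_of_real (exp (f z)))))"

text \<open>The inverse coefficients are defined by
  \<open>\<Sum>l. h\<^sup>k\<^sup>l h\<^sub>j\<^sub>l = \<delta>\<^sub>j\<^sub>k\<close> (second indices barred), so the upper pair \<open>(k,l)\<close> is the
  \<open>(l,k)\<close> entry of the inverse matrix.\<close>

definition christoffel ::
  "(complex^'n \<Rightarrow> complex^'n^'n) \<Rightarrow> 'n \<Rightarrow> 'n \<Rightarrow> 'n \<Rightarrow> complex^'n \<Rightarrow> complex" where
  "christoffel h i j k z =
     (\<Sum>l\<in>UNIV. matrix_inv (h z) $ l $ k * d_z i (\<lambda>w. h w $ j $ l) z)"

definition chern_curvature ::
  "(complex^'n \<Rightarrow> complex^'n^'n) \<Rightarrow> 'n \<Rightarrow> 'n \<Rightarrow> 'n \<Rightarrow> 'n \<Rightarrow> complex^'n \<Rightarrow> complex" where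
  "chern_curvature h i j k l z =
     - (\<Sum>p\<in>UNIV. h z $ p $ l * d_zbar j (christoffel h i k p) z)"

definition hol_sect_curv :: "(complex^'n \<Rightarrow> complex^'n^'n) \<Rightarrow> complex^'n \<Rightarrow> complex^'n \<Rightarrow> complex" where
  "hol_sect_curv h z X =
     (\<Sum>i\<in>UNIV. \<Sum>j\<in>UNIV. \<Sum>k\<in>UNIV. \<Sum>l\<in>UNIV.
        chern_curvature h i j k l z * X $ i * cnj (X $ j) * X $ k * cnj (X $ l))
     / (herm h z X X)\<^sup>2"

text \<open>The form \<open>\<i> \<Sum> h\<^sub>i\<^sub>j dz\<^sup>i \<and> d\<bar>z\<^sup>j\<close> evaluated on real tangent vectors, which are
  identified with elements of complex n-space, so that \<open>dz\<^sup>i u = u $ i\<close>.\<close>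

definition fundamental_form ::
  "(complex^'n \<Rightarrow> complex^'n^'n) \<Rightarrow> complex^'n \<Rightarrow> complex^'n \<Rightarrow> complex^'n \<Rightarrow> complex" where
  "fundamental_form h z u v =
     \<i> * (\<Sum>i\<in>UNIV. \<Sum>j\<in>UNIV. h z $ i $ j * (u $ i * cnj (v $ j) - v $ i * cnj (u $ j)))"

text \<open>Exterior derivative of a 2-form on a vector space, evaluated on constant vector fields
  (whose Lie brackets vanish).\<close>

definition ext_deriv2 ::
  "('a::real_normed_vector \<Rightarrow> 'a \<Rightarrow> 'a \<Rightarrow> 'b::real_normed_vector) \<Rightarrow> 'a \<Rightarrow> 'a \<Rightarrow> 'a \<Rightarrow> 'a \<Rightarrow> 'b" where
  "ext_deriv2 \<omega> z u v w =
     frechet_derivative (\<lambda>x. \<omega> x v w) (at z) u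
     - frechet_derivative (\<lambda>x. \<omega> x u w) (at z) v
     + frechet_derivative (\<lambda>x. \<omega> x u v) (at z) w"

definition kaehler :: "(complex^'n \<Rightarrow> complex^'n^'n) \<Rightarrow> bool" where
  "kaehler h \<longleftrightarrow> (\<forall>z u v w. ext_deriv2 (fundamental_form h) z u v w = 0)"

text \<open>The Riemannian metric \<open>g(u,v) = \<omega>(u,Jv)\<close>; the factor 2 comes from
  \<open>\<i> dz \<and> d\<bar>z = 2 dx \<and> dy\<close>.\<close>

definition riem_metric ::
  "(complex^'n \<Rightarrow> complex^'n^'n) \<Rightarrow> complex^'n \<Rightarrow> complex^'n \<Rightarrow> complex^'n \<Rightarrow> real" where
  "riem_metric h z u v = 2 * Re (herm h z u v)"

text \<open>Infimum of the lengths of piecewise continuously differentiable paths.  A \<open>valid_path\<close> may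
  have unbounded velocity near its finitely many exceptional points, even non-integrable; such
  paths of infinite length are excluded by \<open>has_integral\<close> (whereas \<open>integral\<close> would
  give them length 0).\<close>

definition riem_dist :: "(complex^'n \<Rightarrow> complex^'n^'n) \<Rightarrow> complex^'n \<Rightarrow> complex^'n \<Rightarrow> real" where
  "riem_dist h p q = Inf {L. \<exists>\<gamma>. valid_path \<gamma> \<and> pathstart \<gamma> = p \<and> pathfinish \<gamma> = q \<and>
     ((\<lambda>t. sqrt (riem_metric h (\<gamma> t) (vector_derivative \<gamma> (at t)) (vector_derivative \<gamma> (at t))))
        has_integral L) {0..1}}"

definition complete_metric :: "(complex^'n \<Rightarrow> complex^'n^'n) \<Rightarrow> bool" where
  "complete_metric h \<longleftrightarrow> Metric_space.mcomplete UNIV (riem_dist h)"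

end

theory Submission imports Defs begin

text \<open>For \<open>h = exp f \<cdot> h\<^sub>0\<close> with \<open>h\<^sub>0\<close> Euclidean, the Chern curvature is
  \<open>R\<^sub>i\<^sub>j\<^sub>k\<^sub>l = - exp f \<cdot> (\<partial>\<^sub>i \<partial>\<^sub>j f) \<cdot> \<delta>\<^sub>k\<^sub>l\<close> (\<open>j\<close> and \<open>l\<close> barred), so \<open>f = a |z|\<^sup>2\<close> gives the
  pointwise constant holomorphic sectional curvature \<open>- a exp (- a |z|\<^sup>2)\<close>: negative for
  \<open>a = 1\<close>, positive for \<open>a = - 1\<close>.  For \<open>a = 1\<close> the metric dominates the Euclidean one and is
  comparable to it on bounded sets, hence complete.\<close>

subsection \<open>Closure properties of smooth functions\<close>

text \<open>\<open>frechet_derivative\<close> is a choice term; uniqueness of the derivative allows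
  any explicit formula in its place.\<close>

lemma C_k_SucI:
  assumes "\<And>x. (f has_derivative f' x) (at x)" and "\<And>v. C_k k (\<lambda>x. f' x v)"
  shows "C_k (Suc k) f"
proof -
  have "frechet_derivative f (at x) = f' x" for x
    by (rule frechet_derivative_at[OF assms(1), symmetric])
  then show ?thesis
    using assms by (auto simp: differentiable_def)
qed

lemma C_k_Suc_imp: "C_k (Suc k) f \<Longrightarrow> C_k k f"
proof (induction k arbitrary: f)
  case 0
  then show ?case
    by (auto intro!: continuous_at_imp_continuous_on differentiable_imp_continuous_within)
next
  case (Suc k)
  then show ?case by (metis C_k.simps(2))
qed

lemma C_k_Suc_has_derivative:
  "C_k (Suc k) f \<Longrightarrow> (f has_derivative frechet_derivative f (at x)) (at x)"
  by (simp add: frechet_derivative_works)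

lemma C_k_const: "C_k k (\<lambda>_. c)"
proof (induction k arbitrary: c)
  case (Suc k)
  show ?case by (rule C_k_SucI[where f' = "\<lambda>_ _. 0"]) (auto intro: Suc)
qed auto

lemma C_k_bounded_linear_comp:
  assumes "bounded_linear L" "C_k k f"
  shows "C_k k (\<lambda>x. L (f x))"
  using assms(2)
proof (induction k arbitrary: f)
  case 0
  then show ?case
    by (auto intro: bounded_linear.continuous_on[OF assms(1)])
next
  case (Suc k)
  show ?case
  proof (rule C_k_SucI)
    show "((\<lambda>x. L (f x)) has_derivative (\<lambda>v. L (frechet_derivative f (at x) v))) (at x)" for x
      using bounded_linear.has_derivative[OF assms(1) C_k_Suc_has_derivative[OF Suc.prems]] .
  qed (use Suc in auto)
qed

lemma C_k_id: "C_k k (\<lambda>x. x)"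
proof (cases k)
  case (Suc m)
  show ?thesis
    unfolding Suc by (rule C_k_SucI[where f' = "\<lambda>_ v. v"]) (auto intro: C_k_const)
qed auto

lemma C_k_add:
  assumes "C_k k f" "C_k k g"
  shows "C_k k (\<lambda>x. f x + g x)"
  using assms
proof (induction k arbitrary: f g)
  case (Suc k)
  show ?case
  proof (rule C_k_SucI)
    show "((\<lambda>x. f x + g x) has_derivative
        (\<lambda>v. frechet_derivative f (at x) v + frechet_derivative g (at x) v)) (at x)" for x
      using Suc.prems by (intro has_derivative_add C_k_Suc_has_derivative)
  qed (use Suc in auto)
qed (auto intro: continuous_on_add)

text \<open>The product rule keeps \<open>f\<close> and \<open>g\<close> undifferentiated beside
  their derivatives, so the induction also uses both at the lower order, which
  \<open>C_k_Suc_imp\<close> supplies.\<close>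

lemma C_k_bounded_bilinear:
  assumes "bounded_bilinear B" "C_k k f" "C_k k g"
  shows "C_k k (\<lambda>x. B (f x) (g x))"
  using assms(2,3)
proof (induction k arbitrary: f g)
  case 0
  then show ?case
    by (auto intro: bounded_bilinear.continuous_on[OF assms(1)])
next
  case (Suc k)
  show ?case
  proof (rule C_k_SucI)
    show "((\<lambda>x. B (f x) (g x)) has_derivative
        (\<lambda>v. B (f x) (frechet_derivative g (at x) v) + B (frechet_derivative f (at x) v) (g x))) (at x)" for x
      using Suc.prems
      by (intro bounded_bilinear.FDERIV[OF assms(1)] C_k_Suc_has_derivative)
    show "C_k k (\<lambda>x. B (f x) (frechet_derivative g (at x) v) + B (frechet_derivative f (at x) v) (g x))" for v
      using Suc.prems by (intro C_k_add Suc.IH C_k_Suc_imp[of k f] C_k_Suc_imp[of k g]) auto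
  qed
qed

text \<open>The derivative is the same exponential times a derivative of \<open>f\<close>, so the
  induction hypothesis for the same \<open>f\<close> closes the step.\<close>

lemma C_k_exp:
  fixes f :: "'a::euclidean_space \<Rightarrow> real"
  assumes "C_k k f"
  shows "C_k k (\<lambda>x. exp (f x))"
  using assms
proof (induction k)
  case 0
  then show ?case by (auto intro: continuous_on_exp)
next
  case (Suc k)
  show ?case
  proof (rule C_k_SucI)
    show "((\<lambda>x. exp (f x)) has_derivative (\<lambda>v. exp (f x) * frechet_derivative f (at x) v)) (at x)" for x
      using has_derivative_exp[OF C_k_Suc_has_derivative[OF Suc.prems]] by (simp add: mult.commute)
    show "C_k k (\<lambda>x. exp (f x) * frechet_derivative f (at x) v)" for v
      using Suc C_k_Suc_imp[OF Suc.prems]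
      by (intro C_k_bounded_bilinear[OF bounded_bilinear_mult]) auto
  qed
qed

lemma smooth_scaled_norm_square: "smooth (\<lambda>z. a * (z \<bullet> z))"
  unfolding smooth_def
  by (intro allI C_k_bounded_linear_comp[OF bounded_linear_mult_right]
      C_k_bounded_bilinear[OF bounded_bilinear_inner] C_k_id)

subsection \<open>Distances with a conformal weight\<close>

text \<open>Length for the Euclidean metric scaled by the square of \<open>w\<close>. It is a
  relation rather than a value, so that paths with non-integrable speed have no length, as in
  \<open>riem_dist\<close>.\<close>

definition has_weighted_length :: "('a::euclidean_space \<Rightarrow> real) \<Rightarrow> (real \<Rightarrow> 'a) \<Rightarrow> real \<Rightarrow> bool" where
  "has_weighted_length w \<gamma> L \<longleftrightarrow>
     ((\<lambda>t. w (\<gamma> t) * norm (vector_derivative \<gamma> (at t))) has_integral L) {0..1}"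

definition weighted_dist :: "('a::euclidean_space \<Rightarrow> real) \<Rightarrow> 'a \<Rightarrow> 'a \<Rightarrow> real" where
  "weighted_dist w p q = Inf {L. \<exists>\<gamma>. valid_path \<gamma> \<and> pathstart \<gamma> = p \<and> pathfinish \<gamma> = q \<and>
     has_weighted_length w \<gamma> L}"

section \<open>Path lengths: reparametrization, concatenation and bounds\<close>

lemma valid_path_differentiable:
  assumes "valid_path \<gamma>"
  obtains S where "finite S" "\<And>t. t \<in> {0..1} - S \<Longrightarrow> \<gamma> differentiable at t"
  using assms by (auto simp: valid_path_def piecewise_C1_differentiable_on_def C1_differentiable_on_eq)

text \<open>Chain rule, with agreement asked for only near \<open>t\<close>, because a concatenation
  equals a rescaled piece only locally.\<close>

lemma vector_derivative_affine:
  fixes \<gamma> :: "real \<Rightarrow> 'a::real_normed_vector"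
  assumes "\<gamma> differentiable at (m * t + c)"
    and "0 < d" "\<And>s. \<bar>s - t\<bar> < d \<Longrightarrow> \<eta> s = \<gamma> (m * s + c)"
  shows "vector_derivative \<eta> (at t) = m *\<^sub>R vector_derivative \<gamma> (at (m * t + c))"
proof (rule vector_derivative_at)
  have "((\<lambda>s. m * s + c) has_vector_derivative m) (at t)"
    by (rule derivative_eq_intros | simp)+
  moreover have "(\<gamma> has_vector_derivative vector_derivative \<gamma> (at (m * t + c))) (at (m * t + c))"
    using assms(1) by (simp add: vector_derivative_works)
  ultimately have "(\<gamma> \<circ> (\<lambda>s. m * s + c) has_vector_derivative
      m *\<^sub>R vector_derivative \<gamma> (at (m * t + c))) (at t)"
    by (rule vector_diff_chain_at)
  then show "(\<eta> has_vector_derivative m *\<^sub>R vector_derivative \<gamma> (at (m * t + c))) (at t)"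
    by (rule has_vector_derivative_transform_within[where d = d])
      (use assms in \<open>auto simp: dist_real_def\<close>)
qed

text \<open>Only the values of \<open>\<eta>\<close> on \<open>{u..v}\<close> matter, so this covers reversal as well as both halves
  of a concatenation.\<close>

lemma has_weighted_length_affine:
  assumes len: "has_weighted_length w \<gamma> L" and "valid_path \<gamma>" and "m \<noteq> 0"
    and A: "{u..v} = (\<lambda>x. (1 / m) *\<^sub>R x + - ((1 / m) *\<^sub>R c)) ` {0..1}"
    and eq: "\<And>t. t \<in> {u..v} \<Longrightarrow> \<eta> t = \<gamma> (m * t + c)"
  shows "((\<lambda>t. w (\<eta> t) * norm (vector_derivative \<eta> (at t))) has_integral L) {u..v}"
proof -
  obtain S where S: "finite S" "\<And>t. t \<in> {0..1} - S \<Longrightarrow> \<gamma> differentiable at t"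
    using valid_path_differentiable[OF \<open>valid_path \<gamma>\<close>] by metis
  let ?g = "\<lambda>t. w (\<gamma> t) * norm (vector_derivative \<gamma> (at t))"
  have "((\<lambda>t. ?g (m *\<^sub>R t + c)) has_integral (1 / \<bar>m\<bar>) *\<^sub>R L) {u..v}"
    using has_integral_affinity[of ?g L 0 1 m c] len \<open>m \<noteq> 0\<close>
    by (simp add: has_weighted_length_def A)
  \<comment> \<open>The substitution costs a factor 1/|m|; the factor |m| in the rescaled velocity
    makes up for it.\<close>
  then have int: "((\<lambda>t. \<bar>m\<bar> * ?g (m * t + c)) has_integral L) {u..v}"
    using has_integral_mult_right[of _ "(1 / \<bar>m\<bar>) *\<^sub>R L" "{u..v}" "\<bar>m\<bar>"] \<open>m \<noteq> 0\<close>
    by fastforce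
  show ?thesis
  proof (rule has_integral_spike_finite[OF _ _ int])
    \<comment> \<open>Excluded are the end points, where \<open>\<eta>\<close> is known to agree
      with the rescaled path only on one side, and the preimages of the exceptional points of
      \<open>\<gamma>\<close>.\<close>
    show "finite ({u, v} \<union> (\<lambda>t. m * t + c) -` S)"
      using S(1) \<open>m \<noteq> 0\<close> by (auto intro!: finite_vimageI injI)
    fix t assume t: "t \<in> {u..v} - ({u, v} \<union> (\<lambda>t. m * t + c) -` S)"
    then obtain x where x: "x \<in> {0..1}" "t = (1 / m) *\<^sub>R x + - ((1 / m) *\<^sub>R c)"
      using A by blast
    then have "m * t + c = x"
      using \<open>m \<noteq> 0\<close> by (simp add: field_simps)
    with x t S(2) have "\<gamma> differentiable at (m * t + c)"
      by auto
    then have "vector_derivative \<eta> (at t) = m *\<^sub>R vector_derivative \<gamma> (at (m * t + c))"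
      by (rule vector_derivative_affine[where d = "min (t - u) (v - t)"]) (use t in \<open>auto intro!: eq\<close>)
    then show "w (\<eta> t) * norm (vector_derivative \<eta> (at t)) = \<bar>m\<bar> * ?g (m * t + c)"
      using t by (simp add: eq)
  qed
qed

lemma has_weighted_length_reversepath:
  assumes "has_weighted_length w \<gamma> L" "valid_path \<gamma>"
  shows "has_weighted_length w (reversepath \<gamma>) L"
  unfolding has_weighted_length_def
  by (rule has_weighted_length_affine[OF assms, where m = "- 1" and c = 1])
    (auto simp: reversepath_def image_affinity_atLeastAtMost)

lemma has_weighted_length_join:
  assumes "has_weighted_length w \<gamma> L" "valid_path \<gamma>" "has_weighted_length w \<delta> M" "valid_path \<delta>"
    and "pathfinish \<gamma> = pathstart \<delta>"
  shows "has_weighted_length w (\<gamma> +++ \<delta>) (L + M)"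
proof -
  let ?f = "\<lambda>t. w ((\<gamma> +++ \<delta>) t) * norm (vector_derivative (\<gamma> +++ \<delta>) (at t))"
  have "(?f has_integral L) {0..1/2}"
    by (rule has_weighted_length_affine[OF assms(1,2), where m = 2 and c = 0])
      (auto simp: joinpaths_def image_affinity_atLeastAtMost)
  moreover have "(?f has_integral M) {1/2..1}"
  proof (rule has_weighted_length_affine[OF assms(3,4), where m = 2 and c = "- 1"])
    show "(\<gamma> +++ \<delta>) t = \<delta> (2 * t + - 1)" if "t \<in> {1/2..1}" for t
    proof (cases "t = 1/2")
      \<comment> \<open>At \<open>1/2\<close> the concatenation is given by its first branch, so the
        matching of the end points enters here.\<close>
      case True
      show ?thesis
        unfolding True using assms(5) by (simp add: joinpaths_def pathfinish_def pathstart_def)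
    qed (use that in \<open>auto simp: joinpaths_def\<close>)
  qed (use image_affinity_atLeastAtMost[of "1/2" "1/2" 0 1] in auto)
  ultimately show ?thesis
    unfolding has_weighted_length_def by (rule has_integral_combine[rotated 2]) auto
qed

text \<open>The chord is the integral of the velocity, so its norm is at most the integral of the
  speed, which a weight of at least 1 can only increase.\<close>

lemma norm_diff_le_weighted_length:
  assumes "has_weighted_length w \<gamma> L" "valid_path \<gamma>" and w: "\<And>x. 1 \<le> w x"
  shows "norm (pathfinish \<gamma> - pathstart \<gamma>) \<le> L"
proof -
  obtain S where S: "finite S" "\<And>t. t \<in> {0..1} - S \<Longrightarrow> \<gamma> differentiable at t"
    using valid_path_differentiable[OF \<open>valid_path \<gamma>\<close>] by metis
  let ?D = "\<lambda>t. vector_derivative \<gamma> (at t)"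
  have D: "(?D has_integral (\<gamma> 1 - \<gamma> 0)) {0..1}"
  proof (rule fundamental_theorem_of_calculus_interior_strong[OF S(1)])
    show "continuous_on {0..1} \<gamma>"
      using valid_path_imp_path[OF \<open>valid_path \<gamma>\<close>] by (simp add: path_def)
  qed (use S(2) in \<open>auto simp: vector_derivative_works\<close>)
  have L: "((\<lambda>t. w (\<gamma> t) * norm (?D t)) has_integral L) {0..1}"
    using assms(1) by (simp add: has_weighted_length_def)
  have "norm (integral {0..1} ?D) \<le> integral {0..1} (\<lambda>t. w (\<gamma> t) * norm (?D t))"
  proof (rule Henstock_Kurzweil_Integration.integral_norm_bound_integral)
    show "norm (?D t) \<le> w (\<gamma> t) * norm (?D t)" for t
      using mult_right_mono[OF w[of "\<gamma> t"] norm_ge_zero[of "?D t"]] by simp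
  qed (use D L in \<open>auto simp: has_integral_integrable\<close>)
  then show ?thesis
    using integral_unique[OF D] integral_unique[OF L]
    by (simp add: pathfinish_def pathstart_def)
qed

text \<open>A segment has constant velocity, so the integrand is continuous and the length exists.
  This makes the set in \<open>weighted_dist\<close> nonempty and bounds the distance from
  above.\<close>

lemma has_weighted_length_linepath:
  assumes "continuous_on UNIV w"
  obtains L where "has_weighted_length w (linepath p q) L"
    "\<And>B. (\<And>x. x \<in> closed_segment p q \<Longrightarrow> w x \<le> B) \<Longrightarrow> L \<le> B * norm (q - p)"
proof -
  let ?f = "\<lambda>t. w (linepath p q t) * norm (q - p)"
  have "continuous_on {0..1} ?f"
    by (intro continuous_on_mult continuous_on_const continuous_on_compose2[OF assms] continuous_on_linepath) auto
  then have int: "(?f has_integral integral {0..1} ?f) {0..1}"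
    by (intro integrable_integral integrable_continuous_real)
  show ?thesis
  proof
    show "has_weighted_length w (linepath p q) (integral {0..1} ?f)"
      using int by (simp add: has_weighted_length_def)
    fix B assume B: "\<And>x. x \<in> closed_segment p q \<Longrightarrow> w x \<le> B"
    have "((\<lambda>_. B * norm (q - p)) has_integral (B * norm (q - p))) {0..1::real}"
      using has_integral_const_real[of "B * norm (q - p)" 0 1] by simp
    with int show "integral {0..1} ?f \<le> B * norm (q - p)"
      by (rule has_integral_le) (auto intro!: mult_right_mono B linepath_in_path)
  qed
qed

section \<open>The weighted distance as a complete metric\<close>

context
  fixes w :: "'a::euclidean_space \<Rightarrow> real"
  assumes continuous_weight: "continuous_on UNIV w" and weight_ge_1: "\<And>x. 1 \<le> w x"
begin

text \<open>The Euclidean distance of the end points bounds all competing lengths from below, so the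
  infimum is a true lower bound.\<close>

lemma weighted_dist_le:
  assumes "has_weighted_length w \<gamma> L" "valid_path \<gamma>"
  shows "weighted_dist w (pathstart \<gamma>) (pathfinish \<gamma>) \<le> L"
  unfolding weighted_dist_def
proof (rule cInf_lower)
  show "bdd_below {L. \<exists>\<delta>. valid_path \<delta> \<and> pathstart \<delta> = pathstart \<gamma> \<and> pathfinish \<delta> = pathfinish \<gamma> \<and>
      has_weighted_length w \<delta> L}"
    using norm_diff_le_weighted_length[OF _ _ weight_ge_1]
    by (intro bdd_belowI[where m = "norm (pathfinish \<gamma> - pathstart \<gamma>)"]) fastforce
qed (use assms in auto)

lemma weighted_dist_greatest:
  assumes "\<And>\<gamma> L. valid_path \<gamma> \<Longrightarrow> pathstart \<gamma> = p \<Longrightarrow> pathfinish \<gamma> = q \<Longrightarrow>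
    has_weighted_length w \<gamma> L \<Longrightarrow> B \<le> L"
  shows "B \<le> weighted_dist w p q"
proof -
  obtain L where "has_weighted_length w (linepath p q) L"
    using has_weighted_length_linepath[OF continuous_weight] by metis
  then have "valid_path (linepath p q) \<and> pathstart (linepath p q) = p \<and> pathfinish (linepath p q) = q \<and>
      has_weighted_length w (linepath p q) L"
    by simp
  then show ?thesis
    unfolding weighted_dist_def by (intro cInf_greatest) (use assms in blast)+
qed

lemma dist_le_weighted_dist: "dist p q \<le> weighted_dist w p q"
  by (rule weighted_dist_greatest)
    (metis dist_commute dist_norm norm_diff_le_weighted_length weight_ge_1)

lemma weighted_dist_le_segment:
  assumes "\<And>x. x \<in> closed_segment p q \<Longrightarrow> w x \<le> B"
  shows "weighted_dist w p q \<le> B * dist p q"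
proof -
  obtain L where "has_weighted_length w (linepath p q) L" "L \<le> B * norm (q - p)"
    using has_weighted_length_linepath[OF continuous_weight] assms by metis
  with weighted_dist_le[of "linepath p q" L] show ?thesis
    by (simp add: dist_norm norm_minus_commute)
qed

lemma weighted_dist_commute_le: "weighted_dist w p q \<le> weighted_dist w q p"
proof (rule weighted_dist_greatest)
  fix \<gamma> L assume "valid_path \<gamma>" "pathstart \<gamma> = q" "pathfinish \<gamma> = p" "has_weighted_length w \<gamma> L"
  then show "weighted_dist w p q \<le> L"
    using weighted_dist_le[OF has_weighted_length_reversepath, of \<gamma> L] by simp
qed

text \<open>The two infima on the right are treated one at a time: subtracting the other terms gives
  bounds of the form that \<open>weighted_dist_greatest\<close> proves, which replaces a choice of
  nearly shortest paths.\<close>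

lemma weighted_dist_triangle: "weighted_dist w p r \<le> weighted_dist w p q + weighted_dist w q r"
proof -
  have "weighted_dist w p r - weighted_dist w q r \<le> weighted_dist w p q"
  proof (rule weighted_dist_greatest)
    fix \<gamma> L assume 1: "valid_path \<gamma>" "pathstart \<gamma> = p" "pathfinish \<gamma> = q" "has_weighted_length w \<gamma> L"
    have "weighted_dist w p r - L \<le> weighted_dist w q r"
    proof (rule weighted_dist_greatest)
      fix \<delta> M assume 2: "valid_path \<delta>" "pathstart \<delta> = q" "pathfinish \<delta> = r" "has_weighted_length w \<delta> M"
      have "weighted_dist w (pathstart (\<gamma> +++ \<delta>)) (pathfinish (\<gamma> +++ \<delta>)) \<le> L + M"
        using 1 2 by (intro weighted_dist_le has_weighted_length_join valid_path_join) auto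
      then show "weighted_dist w p r - L \<le> M"
        using 1 2 by simp
    qed
    then show "weighted_dist w p r - weighted_dist w q r \<le> L"
      by simp
  qed
  then show ?thesis
    by simp
qed

lemma Metric_space_weighted_dist: "Metric_space UNIV (weighted_dist w)"
proof
  fix p q r
  show "0 \<le> weighted_dist w p q"
    using dist_le_weighted_dist[of p q] zero_le_dist[of p q] by linarith
  show "weighted_dist w p q = weighted_dist w q p"
    by (intro antisym weighted_dist_commute_le)
  show "weighted_dist w p q = 0 \<longleftrightarrow> p = q"
  proof
    assume "weighted_dist w p q = 0"
    then show "p = q"
      using dist_le_weighted_dist[of p q] by simp
  next
    assume "p = q"
    then show "weighted_dist w p q = 0"
      using weighted_dist_le_segment[of p q "w p"] dist_le_weighted_dist[of p q] by simp
  qed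
qed (rule weighted_dist_triangle)

text \<open>The weighted distance dominates the Euclidean one, so a Cauchy sequence has a Euclidean
  limit; near that limit the weight is bounded, so convergence carries over to the weighted
  distance.\<close>

lemma mcomplete_weighted_dist: "Metric_space.mcomplete UNIV (weighted_dist w)"
proof -
  interpret W: Metric_space UNIV "weighted_dist w"
    by (rule Metric_space_weighted_dist)
  show ?thesis
    unfolding W.mcomplete_def
  proof (intro allI impI)
    fix \<sigma> assume \<sigma>: "W.MCauchy \<sigma>"
    have "Cauchy \<sigma>"
      unfolding Cauchy_def
      using \<sigma> dist_le_weighted_dist unfolding W.MCauchy_def by (meson le_less_trans)
    then obtain x where x: "\<sigma> \<longlonglongrightarrow> x"
      using Cauchy_convergent convergent_def by blast
    obtain B where B: "\<And>y. y \<in> cball x 1 \<Longrightarrow> w y \<le> B"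
    proof -
      have "compact (w ` cball x 1)"
        by (intro compact_continuous_image continuous_on_subset[OF continuous_weight]) auto
      then show ?thesis
        using that by (metis bounded_imp_bdd_above bdd_above.unfold compact_imp_bounded imageI)
    qed
    have "0 < B"
      using B[of x] weight_ge_1[of x] by simp
    have "\<exists>N. \<forall>n\<ge>N. weighted_dist w (\<sigma> n) x < \<epsilon>" if "\<epsilon> > 0" for \<epsilon>
    proof -
      \<comment> \<open>The bound \<open>1\<close> keeps the segment to \<open>x\<close> inside the
        ball where \<open>w\<close> is at most \<open>B\<close>; the bound
        \<open>\<epsilon> / B\<close> makes \<open>B\<close> times the Euclidean distance smaller
        than \<open>\<epsilon>\<close>.\<close>
      have "\<forall>\<^sub>F n in sequentially. dist (\<sigma> n) x < min 1 (\<epsilon> / B)"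
        using \<open>\<epsilon> > 0\<close> \<open>0 < B\<close> by (intro tendstoD[OF x]) simp
      moreover have "weighted_dist w (\<sigma> n) x < \<epsilon>" if n: "dist (\<sigma> n) x < min 1 (\<epsilon> / B)" for n
      proof -
        have "closed_segment (\<sigma> n) x \<subseteq> cball x 1"
          using n by (intro closed_segment_subset convex_cball) (auto simp: dist_commute)
        then have "weighted_dist w (\<sigma> n) x \<le> B * dist (\<sigma> n) x"
          using B by (intro weighted_dist_le_segment) auto
        also have "\<dots> < \<epsilon>"
          using n \<open>0 < B\<close> by (simp add: field_simps)
        finally show ?thesis .
      qed
      ultimately show ?thesis
        by (auto simp: eventually_sequentially)
    qed
    then show "\<exists>x. limitin W.mtopology \<sigma> x sequentially"
      by (auto simp: W.limit_metric_sequentially)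
  qed
qed

end

subsection \<open>The metrics \<open>exp (a |z|\<^sup>2) \<cdot> h\<^sub>0\<close>\<close>

definition gauss_metric :: "real \<Rightarrow> complex^'n \<Rightarrow> complex^'n^'n" where
  "gauss_metric a z = mat (complex_of_real (exp (a * (z \<bullet> z))))"

lemma gauss_metric_nth:
  "gauss_metric a z $ i $ j = (if i = j then complex_of_real (exp (a * (z \<bullet> z))) else 0)"
  by (simp add: gauss_metric_def mat_def)

text \<open>A smooth real factor times a constant matrix is the form to which closure of
  \<open>C_k\<close> under bounded linear maps applies.\<close>

lemma gauss_metric_scaleR: "gauss_metric a z = exp (a * (z \<bullet> z)) *\<^sub>R mat 1"
  by (simp add: vec_eq_iff gauss_metric_nth mat_def) (simp add: scaleR_conv_of_real)

lemma smooth_gauss_metric: "smooth (gauss_metric a :: complex^'n::finite \<Rightarrow> complex^'n^'n)"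
proof -
  have "C_k k (\<lambda>z::complex^'n. exp (a * (z \<bullet> z)) *\<^sub>R (mat 1 :: complex^'n^'n))" for k
    using smooth_scaled_norm_square[of a, where 'a = "complex^'n"]
    by (intro C_k_bounded_linear_comp[OF bounded_linear_scaleR_left] C_k_exp) (simp add: smooth_def)
  then show ?thesis
    by (simp add: smooth_def gauss_metric_scaleR[abs_def])
qed

lemma conformally_flat_gauss_metric:
  "conformally_flat (gauss_metric a :: complex^'n::finite \<Rightarrow> complex^'n^'n)"
  unfolding conformally_flat_def gauss_metric_def using smooth_scaled_norm_square by blast

lemma herm_gauss_metric:
  "herm (gauss_metric a) z X Y = complex_of_real (exp (a * (z \<bullet> z))) * (\<Sum>i\<in>UNIV. X $ i * cnj (Y $ i))"
  by (simp add: herm_def gauss_metric_nth if_distrib[where f = "\<lambda>x. x * _"] sum_distrib_left mult.assoc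
      cong: if_cong)

lemma sum_mult_cnj_self:
  "(\<Sum>i\<in>UNIV. X $ i * cnj (X $ i)) = complex_of_real (X \<bullet> X)"
  by (simp add: inner_vec_def dot_square_norm complex_norm_square del: of_real_power)

lemma herm_gauss_metric_self:
  "herm (gauss_metric a) z X X = complex_of_real (exp (a * (z \<bullet> z)) * (X \<bullet> X))"
  by (simp add: herm_gauss_metric sum_mult_cnj_self)

lemma hermitian_metric_gauss_metric:
  "hermitian_metric (gauss_metric a :: complex^'n::finite \<Rightarrow> complex^'n^'n)"
  by (auto simp: hermitian_metric_def smooth_gauss_metric gauss_metric_nth herm_gauss_metric_self)

section \<open>Chern connection and curvature\<close>

lemma has_derivative_gauss:
  "((\<lambda>w. complex_of_real (exp (a * (w \<bullet> w)))) has_derivative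
     (\<lambda>v. complex_of_real (exp (a * (z \<bullet> z)) * (2 * a * (z \<bullet> v))))) (at z)"
  by (rule derivative_eq_intros refl | simp add: inner_commute algebra_simps)+

lemma frechet_derivative_gauss:
  "frechet_derivative (\<lambda>w. complex_of_real (exp (a * (w \<bullet> w)))) (at z) =
     (\<lambda>v. complex_of_real (exp (a * (z \<bullet> z)) * (2 * a * (z \<bullet> v))))"
  by (rule frechet_derivative_at[OF has_derivative_gauss, symmetric])

text \<open>The real gradient of |z|^2 is 2z, and the Wirtinger combination of its two components in
  coordinate \<open>i\<close> is \<open>cnj (z $ i)\<close>.\<close>

lemma d_z_gauss:
  "d_z i (\<lambda>w. complex_of_real (exp (a * (w \<bullet> w)))) z =
     complex_of_real (a * exp (a * (z \<bullet> z))) * cnj (z $ i)"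
  by (simp add: d_z_def frechet_derivative_gauss inner_axis complex_eq_iff)

lemma d_z_zero: "d_z i (\<lambda>w. 0) z = 0"
  by (simp add: d_z_def)

text \<open>\<open>matrix_inv\<close> is a choice among two-sided inverses, and these are
  unique.\<close>

lemma matrix_inv_eqI:
  fixes A B :: "'a::semiring_1^'n^'n"
  assumes "A ** B = mat 1" "B ** A = mat 1"
  shows "matrix_inv A = B"
proof -
  have "A ** matrix_inv A = mat 1 \<and> matrix_inv A ** A = mat 1"
    unfolding matrix_inv_def by (rule someI[of _ B]) (use assms in simp)
  then show ?thesis
    using assms by (metis matrix_mul_assoc matrix_mul_lid matrix_mul_rid)
qed

lemma matrix_inv_gauss_metric:
  "matrix_inv (gauss_metric a z) = gauss_metric (- a) (z :: complex^'n::finite)"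
proof -
  have "gauss_metric a z ** gauss_metric b z = gauss_metric (a + b) z" for a b
    by (simp add: vec_eq_iff matrix_matrix_mult_def gauss_metric_nth
        if_distrib[where f = "\<lambda>x. x * _"] exp_add ring_distribs cong: if_cong)
  moreover have "gauss_metric 0 z = mat 1"
    by (simp add: gauss_metric_def)
  ultimately show ?thesis
    by (intro matrix_inv_eqI) auto
qed

text \<open>The inverse metric cancels the exponential and leaves the derivative of a |z|^2, which
  is linear in the conjugate coordinates.\<close>

lemma christoffel_gauss_metric:
  "christoffel (gauss_metric a) i j k z = (if j = k then complex_of_real a * cnj (z $ i) else 0)"
proof -
  have *: "d_z i (\<lambda>w. gauss_metric a w $ j $ l) z =
      (if j = l then complex_of_real (a * exp (a * (z \<bullet> z))) * cnj (z $ i) else 0)" for l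
    using d_z_gauss[of i a z] d_z_zero[of i z] by (cases "j = l") (simp_all add: gauss_metric_nth)
  show ?thesis
    unfolding christoffel_def * unfolding matrix_inv_gauss_metric gauss_metric_nth
    by (simp add: if_distrib[where f = "\<lambda>x. x * _"] exp_minus cong: if_cong)
qed

lemma d_zbar_cnj: "d_zbar j (\<lambda>z. c * cnj (z $ i)) z = (if i = j then c else 0)"
proof -
  have "((\<lambda>z. c * cnj (z $ i)) has_derivative (\<lambda>v. c * cnj (v $ i))) (at z)"
    by (intro has_derivative_mult_right has_derivative_cnj bounded_linear_imp_has_derivative
        bounded_linear_vec_nth)
  then have "frechet_derivative (\<lambda>z. c * cnj (z $ i)) (at z) = (\<lambda>v. c * cnj (v $ i))"
    by (rule frechet_derivative_at[symmetric])
  then show ?thesis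
    by (simp add: d_zbar_def axis_def complex_eq_iff)
qed

text \<open>The conjugate derivatives of the Christoffel symbols are constant; lowering the index
  with the metric brings the exponential back once.\<close>

lemma chern_curvature_gauss_metric:
  "chern_curvature (gauss_metric a) i j k l z =
     (if i = j \<and> k = l then - complex_of_real (a * exp (a * (z \<bullet> z))) else 0)"
proof -
  have "d_zbar j (christoffel (gauss_metric a) i k p) z = (if k = p \<and> i = j then complex_of_real a else 0)" for p
    using d_zbar_cnj[of j "complex_of_real a" i z] d_zbar_cnj[of j 0 i z]
    by (cases "k = p") (simp_all add: christoffel_gauss_metric[abs_def])
  then show ?thesis
    by (simp add: chern_curvature_def gauss_metric_nth if_distrib[where f = "\<lambda>x. x * _"] cong: if_cong)
qed

text \<open>The numerator is \<open>- a * exp (a * (z \<bullet> z))\<close> times |X|^4, while the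
  squared norm in the denominator carries the exponential twice, so one factor survives
  inverted.\<close>

lemma hol_sect_curv_gauss_metric:
  assumes "X \<noteq> 0"
  shows "hol_sect_curv (gauss_metric a) z X = complex_of_real (- a * exp (- a * (z \<bullet> z)))"
proof -
  let ?c = "- complex_of_real (a * exp (a * (z \<bullet> z)))"
  \<comment> \<open>The Kronecker conditions become nested conditionals, so that the sums over
    \<open>l\<close> and \<open>j\<close> can collapse.\<close>
  have "(\<Sum>i\<in>UNIV. \<Sum>j\<in>UNIV. \<Sum>k\<in>UNIV. \<Sum>l\<in>UNIV.
        chern_curvature (gauss_metric a) i j k l z * X $ i * cnj (X $ j) * X $ k * cnj (X $ l))
      = (\<Sum>i\<in>UNIV. \<Sum>j\<in>UNIV. \<Sum>k\<in>UNIV. \<Sum>l\<in>UNIV.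
          if l = k then if j = i then ?c * (X $ i * cnj (X $ i)) * (X $ k * cnj (X $ k)) else 0 else 0)"
    by (intro sum.cong refl) (simp add: chern_curvature_gauss_metric mult.assoc)
  also have "\<dots> = (\<Sum>i\<in>UNIV. \<Sum>k\<in>UNIV. ?c * (X $ i * cnj (X $ i)) * (X $ k * cnj (X $ k)))"
  proof (rule sum.cong[OF refl])
    fix i
    show "(\<Sum>j\<in>UNIV. \<Sum>k\<in>UNIV. \<Sum>l\<in>UNIV.
          if l = k then if j = i then ?c * (X $ i * cnj (X $ i)) * (X $ k * cnj (X $ k)) else 0 else 0)
        = (\<Sum>k\<in>UNIV. ?c * (X $ i * cnj (X $ i)) * (X $ k * cnj (X $ k)))"
      \<comment> \<open>With the sum over \<open>k\<close> moved outside, the sum over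
        \<open>l\<close> collapses first and then the one over \<open>j\<close>.\<close>
      by (subst sum.swap) simp
  qed
  also have "\<dots> = ?c * (\<Sum>i\<in>UNIV. X $ i * cnj (X $ i)) * (\<Sum>k\<in>UNIV. X $ k * cnj (X $ k))"
    unfolding mult.assoc sum_product by (simp only: sum_distrib_left mult.assoc)
  finally have "hol_sect_curv (gauss_metric a) z X =
      ?c * complex_of_real ((X \<bullet> X)\<^sup>2) / complex_of_real ((exp (a * (z \<bullet> z)) * (X \<bullet> X))\<^sup>2)"
    by (simp add: hol_sect_curv_def herm_gauss_metric_self sum_mult_cnj_self power2_eq_square)
  also have "\<dots> = complex_of_real (- (a * exp (a * (z \<bullet> z))) * (X \<bullet> X)\<^sup>2 / (exp (a * (z \<bullet> z)) * (X \<bullet> X))\<^sup>2)"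
    by simp
  finally have curv: "hol_sect_curv (gauss_metric a) z X =
      complex_of_real (- (a * exp (a * (z \<bullet> z))) * (X \<bullet> X)\<^sup>2 / (exp (a * (z \<bullet> z)) * (X \<bullet> X))\<^sup>2)" .
  have "- (a * E) * q\<^sup>2 / (E * q)\<^sup>2 = - a / E" if "E \<noteq> 0" "q \<noteq> 0" for E q :: real
    using that by (simp add: power2_eq_square)
  then have "- (a * exp (a * (z \<bullet> z))) * (X \<bullet> X)\<^sup>2 / (exp (a * (z \<bullet> z)) * (X \<bullet> X))\<^sup>2
      = - a * exp (- a * (z \<bullet> z))"
    using assms by (simp add: exp_minus divide_inverse[of a])
  with curv show ?thesis
    by (simp only:)
qed

section \<open>Failure of the Kaehler condition, nonconstancy and completeness\<close>

lemma not_kaehler_gauss_metric: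
  assumes "a \<noteq> 0" "CARD('n::finite) \<ge> 2"
  shows "\<not> kaehler (gauss_metric a :: complex^'n \<Rightarrow> complex^'n^'n)"
proof
  assume K: "kaehler (gauss_metric a :: complex^'n \<Rightarrow> complex^'n^'n)"
  obtain i j :: 'n where "i \<noteq> j"
    using assms(2) card_le_Suc0_iff_eq[of "UNIV :: 'n set"] by fastforce
  \<comment> \<open>With f = a |z|^2, the exterior derivative of the form is df wedge the form.
    \<open>?v\<close> and \<open>?w\<close> span the complex line of coordinate \<open>j\<close>, on
    which the form is nonzero; \<open>?u\<close> lies in the line of coordinate \<open>i\<close>, so
    only the derivative along \<open>?u\<close> survives.\<close>
  let ?u = "axis i 1 :: complex^'n" and ?v = "axis j 1 :: complex^'n" and ?w = "axis j \<i> :: complex^'n"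
  have form: "fundamental_form (gauss_metric a) z x y =
      \<i> * complex_of_real (exp (a * (z \<bullet> z))) * (\<Sum>k\<in>UNIV. x $ k * cnj (y $ k) - y $ k * cnj (x $ k))"
    for z x y :: "complex^'n"
    by (simp add: fundamental_form_def gauss_metric_nth if_distrib[where f = "\<lambda>x. x * _"]
        sum_distrib_left mult.assoc cong: if_cong)
  have sum_vw: "(\<Sum>k\<in>UNIV. ?v $ k * cnj (?w $ k) - ?w $ k * cnj (?v $ k)) = - 2 * \<i>"
  proof -
    have "?v $ k * cnj (?w $ k) - ?w $ k * cnj (?v $ k) = (if k = j then - 2 * \<i> else 0)" for k
      by (simp add: axis_def)
    then show ?thesis
      by simp
  qed
  have vw: "fundamental_form (gauss_metric a) z ?v ?w = 2 * complex_of_real (exp (a * (z \<bullet> z)))" for z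
    unfolding form sum_vw by (simp add: complex_eq_iff)
  have uv: "fundamental_form (gauss_metric a) z ?u ?v = 0" "fundamental_form (gauss_metric a) z ?u ?w = 0" for z
    using \<open>i \<noteq> j\<close> by (auto simp: form axis_def intro!: sum.neutral)
  have "((\<lambda>z::complex^'n. 2 * complex_of_real (exp (a * (z \<bullet> z)))) has_derivative
      (\<lambda>v. 2 * complex_of_real (exp (a * (z \<bullet> z)) * (2 * a * (z \<bullet> v))))) (at z)" for z
    by (rule has_derivative_mult_right[OF has_derivative_gauss])
  then have "frechet_derivative (\<lambda>z::complex^'n. 2 * complex_of_real (exp (a * (z \<bullet> z)))) (at z) =
      (\<lambda>v. 2 * complex_of_real (exp (a * (z \<bullet> z)) * (2 * a * (z \<bullet> v))))" for z
    by (rule frechet_derivative_at[symmetric])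
  \<comment> \<open>The base point is \<open>?u\<close> rather than the origin, where df vanishes;
    at \<open>?u\<close>, df takes the value 2a on \<open>?u\<close>.\<close>
  then have "ext_deriv2 (fundamental_form (gauss_metric a)) ?u ?u ?v ?w = 4 * complex_of_real (a * exp a)"
    by (simp add: ext_deriv2_def vw uv inner_axis)
  with K assms(1) show False
    by (simp add: kaehler_def)
qed

lemma not_constant_gauss_curvature:
  assumes "a \<noteq> 0"
  shows "\<not> (\<lambda>z::complex^'n::finite. - a * exp (- a * (z \<bullet> z))) constant_on UNIV"
proof
  assume "(\<lambda>z::complex^'n. - a * exp (- a * (z \<bullet> z))) constant_on UNIV"
  \<comment> \<open>The origin and a unit vector give the values \<open>- a\<close> and
    \<open>- a * exp (- a)\<close>, which differ.\<close>
  then have "- a * exp (- a * ((0::complex^'n) \<bullet> 0)) = - a * exp (- a * (axis k 1 \<bullet> axis k (1::complex)))"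
    for k :: 'n
    unfolding constant_on_def by (metis UNIV_I)
  with assms show False
    by (simp add: inner_axis_axis)
qed

text \<open>The length density is a weight times the Euclidean norm, so the Riemannian distance is a
  weighted one; nonnegativity of \<open>a\<close> keeps the weight at least 1.\<close>

lemma complete_metric_gauss_metric:
  assumes "a \<ge> 0"
  shows "complete_metric (gauss_metric a :: complex^'n::finite \<Rightarrow> complex^'n^'n)"
proof -
  let ?w = "\<lambda>z::complex^'n. sqrt (2 * exp (a * (z \<bullet> z)))"
  have "sqrt (riem_metric (gauss_metric a) z v v) = ?w z * norm v" for z v :: "complex^'n"
    by (simp add: riem_metric_def herm_gauss_metric_self real_sqrt_mult norm_eq_sqrt_inner)
  then have "riem_dist (gauss_metric a) = weighted_dist ?w"
    by (simp add: riem_dist_def weighted_dist_def has_weighted_length_def fun_eq_iff)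
  moreover have "1 \<le> ?w z" for z
  proof -
    have "1 \<le> exp (a * (z \<bullet> z))"
      using assms by simp
    then have "1 \<le> 2 * exp (a * (z \<bullet> z))"
      by linarith
    then show ?thesis
      by simp
  qed
  then have "Metric_space.mcomplete UNIV (weighted_dist ?w)"
    by (intro mcomplete_weighted_dist continuous_intros)
  ultimately show ?thesis
    by (simp add: complete_metric_def)
qed

theorem proposition1p4:
  assumes "CARD('n::finite) \<ge> 2"
  shows
    "(\<exists>(h :: complex^'n \<Rightarrow> complex^'n^'n) (c :: complex^'n \<Rightarrow> real).
        hermitian_metric h \<and> conformally_flat h \<and> complete_metric h \<and> \<not> kaehler h
        \<and> (\<forall>p X. X \<noteq> 0 \<longrightarrow> hol_sect_curv h p X = complex_of_real (c p))
        \<and> (\<forall>p. c p < 0) \<and> \<not> c constant_on UNIV)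
     \<and> (\<exists>(h :: complex^'n \<Rightarrow> complex^'n^'n) (c :: complex^'n \<Rightarrow> real).
        hermitian_metric h \<and> conformally_flat h \<and> \<not> kaehler h
        \<and> (\<forall>p X. X \<noteq> 0 \<longrightarrow> hol_sect_curv h p X = complex_of_real (c p))
        \<and> (\<forall>p. c p > 0) \<and> \<not> c constant_on UNIV)"
proof (intro conjI)
  show "\<exists>(h :: complex^'n \<Rightarrow> complex^'n^'n) (c :: complex^'n \<Rightarrow> real).
        hermitian_metric h \<and> conformally_flat h \<and> complete_metric h \<and> \<not> kaehler h
        \<and> (\<forall>p X. X \<noteq> 0 \<longrightarrow> hol_sect_curv h p X = complex_of_real (c p))
        \<and> (\<forall>p. c p < 0) \<and> \<not> c constant_on UNIV"
    \<comment> \<open>The curvature function keeps the literal shape of the general formula at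
      \<open>a = 1\<close>, so that the lemmas unify with the goals.\<close>
    by (rule exI[of _ "gauss_metric 1"], rule exI[of _ "\<lambda>z. - 1 * exp (- 1 * (z \<bullet> z))"],
        intro conjI hermitian_metric_gauss_metric conformally_flat_gauss_metric
        complete_metric_gauss_metric not_kaehler_gauss_metric not_constant_gauss_curvature
        hol_sect_curv_gauss_metric allI impI) (use assms in auto)
next
  show "\<exists>(h :: complex^'n \<Rightarrow> complex^'n^'n) (c :: complex^'n \<Rightarrow> real).
        hermitian_metric h \<and> conformally_flat h \<and> \<not> kaehler h
        \<and> (\<forall>p X. X \<noteq> 0 \<longrightarrow> hol_sect_curv h p X = complex_of_real (c p))
        \<and> (\<forall>p. c p > 0) \<and> \<not> c constant_on UNIV"
    \<comment> \<open>At \<open>a = - 1\<close> the curvature is exp(|z|^2); the double negations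
      again preserve the shape of the general formula.\<close>
    by (rule exI[of _ "gauss_metric (- 1)"], rule exI[of _ "\<lambda>z. - (- 1) * exp (- (- 1) * (z \<bullet> z))"],
        intro conjI hermitian_metric_gauss_metric conformally_flat_gauss_metric
        not_kaehler_gauss_metric not_constant_gauss_curvature
        hol_sect_curv_gauss_metric allI impI) (use assms in auto)
qed

end
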